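(* Let $\varepsilon>0$, $\mu\in\mathbb{R}$, and let $j\ge1$ iterations of inexact infinite GMRES be applied to $(K_m-\mu M_m)v=c_m$ as described in the context, producing $Q_{j+1}$, $\tilde Z_j$, $\underline H_j$, the least-squares solutions $w_i$ ($i=1,\ldots,j$), and the approximation $\tilde v_j(\mu)=\tilde Z_jw_j$. Let $$r_j=c_m-(K_m-\mu M_m)\tilde Z_jw_j$$ be the residual at iteration $j$, let $$\tilde r_i=Q_{i+1}\big(e_1\|c_m\|-(\underline I_i-\mu\underline H_i)w_i\big),\qquad i=1,\ldots,j,$$ be the exact residuals, with $\tilde r_0=c_m$, and let $p_i=K_m\tilde z_i-q_i$ be the inner residuals. If at each iteration $i\le j$ the inner residual satisfies $$\|p_i\|\le\frac{\sigma_j(\underline I_j-\mu\underline H_j)}{j}\,\frac{1}{\|\tilde r_{i-1}\|}\,\varepsilon,$$ then $$\delta_j:=\|r_j-\tilde r_j\|\le\varepsilon .$$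
   Context: Setting: $A_0,\ldots,A_m\in\mathbb{R}^{n\times n}$ with $A_0$ nonsingular, $b\in\mathbb{R}^n\setminus\{0\}$, $m\ge j$. In $n\times n$ blocks, $K_m\in\mathbb{R}^{(m+1)n\times(m+1)n}$ has first block row $[A_0,A_1,\ldots,A_m]$, identity blocks in diagonal positions $2,\ldots,m+1$, and zeros elsewhere; $M_m$ has identity blocks on the first block subdiagonal and zeros elsewhere; $c_m=[b^T,0,\ldots,0]^T$. The inverse of $K_m$ is $$K_m^{-1}=\begin{bmatrix}A_0^{-1}&-A_0^{-1}A_1&\cdots&-A_0^{-1}A_m\\&I&&\\&&\ddots&\\&&&I\end{bmatrix},$$ and $\tilde K_{m_i}^{-1}$ is obtained by replacing $A_0^{-1}$ in this formula by an approximation $\tilde A_0^{-1}\in\mathbb{R}^{n\times n}$ that may change with the iteration $i$. Inexact infinite GMRES, run for $j$ iterations without breakdown: $q_1=c_m/\|c_m\|$; for $i=1,\ldots,j$ compute $\tilde z_i=\tilde K_{m_i}^{-1}q_i$, $y=M_m\tilde z_i$, $h_i=Q_i^Ty$, $y_\perp=y-Q_ih_i$, $\beta_i=\|y_\perp\|$, $q_{i+1}=y_\perp/\beta_i$, where $Q_i=[q_1,\ldots,q_i]$ has orthonormal columns. The upper Hessenberg matrices are $\underline H_i=\begin{bmatrix}\underline H_{i-1}&h_i\\0&\beta_i\end{bmatrix}\in\mathbb{R}^{(i+1)\times i}$, and with $\tilde Z_i=[\tilde z_1,\ldots,\tilde z_i]$ one has $M_m\tilde Z_i=Q_{i+1}\underline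 H_i$. $\underline I_i\in\mathbb{R}^{(i+1)\times i}$ is the $i\times i$ identity with an extra row of zeros, $e_1$ is the first unit vector, and $$w_i\in\operatorname*{argmin}_{w\in\mathbb{R}^i}\big\|(\underline I_i-\mu\underline H_i)w-e_1\|c_m\|\big\|_2 .$$ $\sigma_j(B)$ denotes the $j$th largest singular value of $B$ (for the $(j+1)\times j$ matrix here, the smallest one). $\|\cdot\|$ is the Euclidean norm. It is understood that $\tilde r_{i-1}\ne0$ for $i=1,\ldots,j$, so that the stated bound makes sense. *)

theory Defs
  imports Complex_Main "Jordan_Normal_Form.Char_Poly" "HOL-Library.Multiset"
begin

definition vnorm :: "real vec \<Rightarrow> real" where
  "vnorm v = sqrt (v \<bullet> v)"

(* The singular values of B are the square roots of the eigenvalues of B\<^sup>T B, counted with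
   algebraic multiplicity. The symmetric matrix B\<^sup>T B has real spectrum, so the real roots of
   its characteristic polynomial are all of its eigenvalues. The list is in decreasing order
   and has dim_col B entries; if dim_col B > dim_row B, it ends in surplus zeros. *)
definition singular_values :: "real mat \<Rightarrow> real list" where
  "singular_values B =
     rev (sorted_list_of_multiset (image_mset sqrt (proots (char_poly (B\<^sup>T * B)))))"

(* The k-th largest singular value, k = 1, 2, ...; list positions start at 0. *)
definition sigma :: "nat \<Rightarrow> real mat \<Rightarrow> real" where
  "sigma k B = singular_values B ! (k - 1)"

(* p by p blocks of size n by n; block positions (k, l) start at 0. *)
definition block_matrix :: "nat \<Rightarrow> nat \<Rightarrow> (nat \<Rightarrow> nat \<Rightarrow> real mat) \<Rightarrow> real mat" where
  "block_matrix n p F =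
     mat (p * n) (p * n) (\<lambda>(r, s). F (r div n) (s div n) $$ (r mod n, s mod n))"

definition K_mat :: "nat \<Rightarrow> nat \<Rightarrow> (nat \<Rightarrow> real mat) \<Rightarrow> real mat" where
  "K_mat n m A = block_matrix n (m + 1)
     (\<lambda>k l. if k = 0 then A l else if k = l then 1\<^sub>m n else 0\<^sub>m n n)"

definition M_mat :: "nat \<Rightarrow> nat \<Rightarrow> real mat" where
  "M_mat n m = block_matrix n (m + 1) (\<lambda>k l. if k = Suc l then 1\<^sub>m n else 0\<^sub>m n n)"

(* The block formula for the inverse of K_mat n m A, with X in every place of the inverse
   of A 0. It is the inverse only if X is the inverse of A 0. *)
definition K_inv_approx :: "nat \<Rightarrow> nat \<Rightarrow> (nat \<Rightarrow> real mat) \<Rightarrow> real mat \<Rightarrow> real mat" where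
  "K_inv_approx n m A X = block_matrix n (m + 1)
     (\<lambda>k l. if k = 0 then (if l = 0 then X else - (X * A l))
            else if k = l then 1\<^sub>m n else 0\<^sub>m n n)"

definition c_vec :: "nat \<Rightarrow> nat \<Rightarrow> real vec \<Rightarrow> real vec" where
  "c_vec n m b = b @\<^sub>v 0\<^sub>v (m * n)"

(* The matrix [x 1, ..., x i] with N rows. *)
definition cols_upto :: "nat \<Rightarrow> (nat \<Rightarrow> real vec) \<Rightarrow> nat \<Rightarrow> real mat" where
  "cols_upto N x i = mat_of_cols N (map x [1..<Suc i])"

(* j iterations without breakdown (\<beta> i \<noteq> 0), where Kinv i is the approximate inverse applied in
   iteration i. Values of the sequences at indices the iteration does not reach are
   unconstrained. Orthonormality of the q i is a consequence and is not assumed. *)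
definition inexact_infinite_gmres ::
  "(nat \<Rightarrow> real mat) \<Rightarrow> real mat \<Rightarrow> real vec \<Rightarrow> nat \<Rightarrow>
   (nat \<Rightarrow> real vec) \<Rightarrow> (nat \<Rightarrow> real vec) \<Rightarrow> (nat \<Rightarrow> real vec) \<Rightarrow> (nat \<Rightarrow> real) \<Rightarrow> bool" where
  "inexact_infinite_gmres Kinv M c j q z h \<beta> \<longleftrightarrow>
     q 1 = (1 / vnorm c) \<cdot>\<^sub>v c \<and>
     (\<forall>i\<in>{1..j}.
        z i = Kinv i *\<^sub>v q i \<and>
        (let Q = cols_upto (dim_vec c) q i;
             y = M *\<^sub>v z i;
             y_perp = y - Q *\<^sub>v h i
         in h i = Q\<^sup>T *\<^sub>v y \<and>
            \<beta> i = vnorm y_perp \<and>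
            \<beta> i \<noteq> 0 \<and>
            q (i + 1) = (1 / \<beta> i) \<cdot>\<^sub>v y_perp))"

primrec hessenberg :: "(nat \<Rightarrow> real vec) \<Rightarrow> (nat \<Rightarrow> real) \<Rightarrow> nat \<Rightarrow> real mat" where
  "hessenberg h \<beta> 0 = 0\<^sub>m 1 0"
| "hessenberg h \<beta> (Suc i) =
     four_block_mat (hessenberg h \<beta> i) (mat_of_cols (Suc i) [h (Suc i)])
                    (0\<^sub>m 1 i)           (mat 1 1 (\<lambda>_. \<beta> (Suc i)))"

definition I_under :: "nat \<Rightarrow> real mat" where
  "I_under i = mat (i + 1) i (\<lambda>(r, s). if r = s then 1 else 0)"

end

theory Submission
  imports Defs "HOL-Analysis.L2_Norm"
begin

text \<open>
  Let \<open>G = I_under j - \<mu> H\<^sub>j\<close>. The Arnoldi relation \<open>M Z\<^sub>j = Q\<^bsub>j+1\<^esub> H\<^sub>j\<close> turns the gap between the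
  true and the exact residual into \<open>- P w\<^sub>j\<close>, where \<open>P\<close> has the inner residuals as columns. The
  \<open>i\<close>-th entry of \<open>w\<^sub>j\<close> is small once the residual at step \<open>i - 1\<close> is: pad \<open>w\<^bsub>i-1\<^esub>\<close> with
  zeros to a vector \<open>u\<close> of length \<open>j\<close>. Since \<open>H\<^sub>j\<close> is upper Hessenberg, \<open>u\<close> has residual norm
  \<open>\<parallel>rt (i - 1)\<parallel>\<close> in the least-squares problem of step \<open>j\<close>, and \<open>G (w\<^sub>j - u)\<close> is the
  orthogonal projection of that residual onto the range of \<open>G\<close>. As \<open>u\<close> vanishes at position
  \<open>i\<close>, the \<open>i\<close>-th entry of \<open>w\<^sub>j\<close> times the smallest singular value of \<open>G\<close> is at most
  \<open>\<parallel>rt (i - 1)\<parallel>\<close>, which cancels the denominator in the bound on the inner residual.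
\<close>

subsection \<open>The smallest singular value\<close>

lemma scalar_prod_self_ge_0: "(0::real) \<le> x \<bullet> x"
  by (simp add: scalar_prod_def sum_nonneg)

lemma scalar_prod_self_pos:
  fixes x :: "real vec"
  assumes "x \<in> carrier_vec n" "x \<noteq> 0\<^sub>v n"
  shows "0 < x \<bullet> x"
proof -
  obtain k where "k < n" "x $ k \<noteq> 0"
    using assms by (metis carrier_vecD eq_vecI index_zero_vec(1,2))
  then have "0 < (\<Sum>i<n. x $ i * x $ i)"
    by (intro sum_pos2[of _ k]) (auto simp: zero_less_mult_iff linorder_neq_iff)
  then show ?thesis
    using assms(1) by (simp add: scalar_prod_def lessThan_atLeast0)
qed

text \<open>Each product of two coordinates of \<open>x\<close> is at most
  \<open>x \<bullet> x\<close> in absolute value, so the sum of the absolute entries of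
  \<open>A\<close> serves as a bound. The 1 added to it makes the constant positive even for the
  zero matrix, so that it can be divided by.\<close>

lemma quadratic_form_bounded:
  fixes A :: "real mat"
  assumes "A \<in> carrier_mat n n"
  obtains N where "N > 0" "\<And>x. x \<in> carrier_vec n \<Longrightarrow> \<bar>x \<bullet> (A *\<^sub>v x)\<bar> \<le> N * (x \<bullet> x)"
proof
  let ?N = "\<Sum>r<n. \<Sum>s<n. \<bar>A $$ (r, s)\<bar>"
  show "?N + 1 > 0" by (simp add: add_nonneg_pos sum_nonneg)
  fix x :: "real vec" assume x: "x \<in> carrier_vec n"
  have entry: "\<bar>x $ r * x $ s\<bar> \<le> x \<bullet> x" if "r < n" "s < n" for r s
  proof -
    have "(x $ k)\<^sup>2 \<le> x \<bullet> x" if "k < n" for k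
      using member_le_sum[of k "{0..<n}" "\<lambda>i. (x $ i)\<^sup>2"] x that
      by (simp add: scalar_prod_def power2_eq_square)
    moreover have "2 * \<bar>x $ r * x $ s\<bar> \<le> (x $ r)\<^sup>2 + (x $ s)\<^sup>2"
      using sum_squares_bound[of "\<bar>x $ r\<bar>" "\<bar>x $ s\<bar>"] by (simp add: abs_mult)
    ultimately show ?thesis using that by (smt (verit))
  qed
  have "x \<bullet> (A *\<^sub>v x) = (\<Sum>r<n. \<Sum>s<n. A $$ (r, s) * (x $ r * x $ s))"
    using x assms
    by (simp add: scalar_prod_def lessThan_atLeast0 sum_distrib_left mult_ac)
  also have "\<bar>\<dots>\<bar> \<le> (\<Sum>r<n. \<Sum>s<n. \<bar>A $$ (r, s) * (x $ r * x $ s)\<bar>)"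
    by (intro order_trans[OF sum_abs] sum_mono order_refl)
  also have "\<dots> \<le> (\<Sum>r<n. \<Sum>s<n. \<bar>A $$ (r, s)\<bar> * (x \<bullet> x))"
    unfolding abs_mult[of "A $$ _"] by (intro sum_mono mult_left_mono entry) auto
  also have "\<dots> \<le> (?N + 1) * (x \<bullet> x)"
    using scalar_prod_self_ge_0[of x] by (simp add: sum_distrib_right sum_distrib_left algebra_simps)
  finally show "\<bar>x \<bullet> (A *\<^sub>v x)\<bar> \<le> (?N + 1) * (x \<bullet> x)" .
qed

lemma symmetric_mat_scalar_prod:
  fixes B :: "real mat"
  assumes "B \<in> carrier_mat n n" "B\<^sup>T = B" "x \<in> carrier_vec n" "y \<in> carrier_vec n"
  shows "x \<bullet> (B *\<^sub>v y) = y \<bullet> (B *\<^sub>v x)"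
  using transpose_vec_mult_scalar[OF assms(1,4,3)] assms
  by (metis comm_scalar_prod mult_mat_vec_carrier)

text \<open>The form is evaluated at \<open>x + t \<cdot>\<^sub>v y\<close>, where \<open>y\<close>
  is the preimage of \<open>x\<close> under \<open>C\<close>. The mixed terms then reduce to
  \<open>x \<bullet> x\<close>, and a negative \<open>t\<close> turns nonnegativity into a strict
  lower bound without diagonalizing \<open>C\<close>.\<close>

lemma invertible_psd_form_lower_bound:
  fixes C :: "real mat"
  assumes C: "C \<in> carrier_mat n n" and sym: "C\<^sup>T = C" and det: "det C \<noteq> 0"
    and psd: "\<And>x. x \<in> carrier_vec n \<Longrightarrow> 0 \<le> x \<bullet> (C *\<^sub>v x)"
  obtains d where "d > 0" "\<And>x. x \<in> carrier_vec n \<Longrightarrow> d * (x \<bullet> x) \<le> x \<bullet> (C *\<^sub>v x)"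
proof -
  obtain D where D: "D \<in> carrier_mat n n" "C * D = 1\<^sub>m n"
    using det_non_zero_imp_unit[OF C det, of "()"] by (auto simp: Units_def ring_mat_simps)
  obtain N where N: "N > 0" "\<And>x. x \<in> carrier_vec n \<Longrightarrow> \<bar>x \<bullet> (D *\<^sub>v x)\<bar> \<le> N * (x \<bullet> x)"
    using quadratic_form_bounded[OF D(1)] by blast
  have "1 / N * (x \<bullet> x) \<le> x \<bullet> (C *\<^sub>v x)" if x: "x \<in> carrier_vec n" for x
  proof -
    \<comment> \<open>This \<open>t\<close> minimizes \<open>2 * t + N * t * t\<close>, the factor
      of \<open>x \<bullet> x\<close> in the estimate below; the minimum is
      \<open>- 1 / N\<close>.\<close>
    define t where "t = - 1 / N"
    define y where "y = D *\<^sub>v x"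
    have y: "y \<in> carrier_vec n" using D x by (simp add: y_def)
    have Cy: "C *\<^sub>v y = x"
      using assoc_mult_mat_vec[OF C D(1) x] D x by (simp add: y_def)
    have yx: "y \<bullet> x \<le> N * (x \<bullet> x)"
      using N(2)[OF x] comm_scalar_prod[OF x y] by (simp add: y_def)
    have xCy: "y \<bullet> (C *\<^sub>v x) = x \<bullet> x"
      using symmetric_mat_scalar_prod[OF C sym x y] Cy by simp
    have "0 \<le> (x + t \<cdot>\<^sub>v y) \<bullet> (C *\<^sub>v (x + t \<cdot>\<^sub>v y))"
      using x y by (intro psd) auto
    also have "C *\<^sub>v (x + t \<cdot>\<^sub>v y) = C *\<^sub>v x + t \<cdot>\<^sub>v x"
      using C x y Cy by (simp add: mult_add_distrib_mat_vec[of _ n n] mult_mat_vec[of _ n n])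
    also have "(x + t \<cdot>\<^sub>v y) \<bullet> \<dots> = x \<bullet> (C *\<^sub>v x) + 2 * t * (x \<bullet> x) + t * t * (y \<bullet> x)"
      using C x y xCy
      by (simp add: add_scalar_prod_distrib[of _ n] scalar_prod_add_distrib[of _ n] algebra_simps)
    also have "\<dots> \<le> x \<bullet> (C *\<^sub>v x) + 2 * t * (x \<bullet> x) + t * t * (N * (x \<bullet> x))"
      using yx by (intro add_left_mono mult_left_mono) auto
    also have "\<dots> = x \<bullet> (C *\<^sub>v x) - 1 / N * (x \<bullet> x)"
      using N(1) by (simp add: t_def field_simps)
    finally show ?thesis by simp
  qed
  then show thesis using that[of "1 / N"] N(1) by simp
qed

text \<open>The supremum \<open>k\<close> of the lower bounds of the Rayleigh quotient is an eigenvalue: otherwise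
  \<open>B - k I\<close> is invertible and positive semidefinite, so the bound could be raised.\<close>

lemma symmetric_mat_min_eigenvalue:
  fixes B :: "real mat"
  assumes B: "B \<in> carrier_mat n n" and sym: "B\<^sup>T = B" and n: "n > 0"
  obtains k where "eigenvalue B k" "\<And>x. x \<in> carrier_vec n \<Longrightarrow> k * (x \<bullet> x) \<le> x \<bullet> (B *\<^sub>v x)"
proof -
  define S where "S = {t. \<forall>x\<in>carrier_vec n. t * (x \<bullet> x) \<le> x \<bullet> (B *\<^sub>v x)}"
  obtain N where N: "\<And>x. x \<in> carrier_vec n \<Longrightarrow> \<bar>x \<bullet> (B *\<^sub>v x)\<bar> \<le> N * (x \<bullet> x)"
    using quadratic_form_bounded[OF B] by blast
  have "- N \<in> S" using N by (fastforce simp: S_def)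
  have upper: "t \<le> (x \<bullet> (B *\<^sub>v x)) / (x \<bullet> x)" if "t \<in> S" "x \<in> carrier_vec n" "x \<noteq> 0\<^sub>v n" for t x
    using that scalar_prod_self_pos[of x n] by (auto simp: S_def field_simps)
  \<comment> \<open>Together with \<open>- N \<in> S\<close> this makes the supremum meaningful. As
    \<open>n > 0\<close>, there is a unit vector, and its Rayleigh quotient bounds
    \<open>S\<close>.\<close>
  have bdd: "bdd_above S"
    using upper[OF _ unit_vec_carrier[of n 0]] n unit_vec_nonzero[of 0 n]
    by (auto intro!: bdd_aboveI)
  define k where "k = Sup S"
  have k: "k * (x \<bullet> x) \<le> x \<bullet> (B *\<^sub>v x)" if x: "x \<in> carrier_vec n" for x
  proof (cases "x = 0\<^sub>v n")
    case True
    then show ?thesis using B by (simp add: mult_mat_vec_carrier[OF B])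
  next
    case False
    then have "k \<le> (x \<bullet> (B *\<^sub>v x)) / (x \<bullet> x)"
      unfolding k_def using upper[OF _ x] \<open>- N \<in> S\<close> by (intro cSup_least) auto
    then show ?thesis using scalar_prod_self_pos[OF x False] by (simp add: field_simps)
  qed
  define C where "C = char_matrix B k"
  have C: "C \<in> carrier_mat n n" using B by (simp add: C_def)
  have Cx: "x \<bullet> (C *\<^sub>v x) = x \<bullet> (B *\<^sub>v x) - k * (x \<bullet> x)" if x: "x \<in> carrier_vec n" for x
  proof -
    have "C *\<^sub>v x = B *\<^sub>v x + (- k) \<cdot>\<^sub>v x"
      using B x unfolding C_def char_matrix_def
      by (intro eq_vecI) (auto simp: add_scalar_prod_distrib[of _ n] smult_scalar_prod_distrib[of _ n] row_one)
    then show ?thesis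
      using B x by (simp add: scalar_prod_add_distrib[of _ n])
  qed
  have "eigenvalue B k"
  proof (rule ccontr)
    assume "\<not> eigenvalue B k"
    then have "det C \<noteq> 0" using eigenvalue_det[OF B] by (simp add: C_def)
    moreover have "C\<^sup>T = C"
    proof (rule eq_matI)
      fix r s assume "r < dim_row C" "s < dim_col C"
      then show "C\<^sup>T $$ (r, s) = C $$ (r, s)"
        using B C arg_cong[OF sym, of "\<lambda>M. M $$ (r, s)"]
        by (auto simp: C_def char_matrix_def)
    qed (use C in auto)
    ultimately obtain d where d: "d > 0" "\<And>x. x \<in> carrier_vec n \<Longrightarrow> d * (x \<bullet> x) \<le> x \<bullet> (C *\<^sub>v x)"
      using invertible_psd_form_lower_bound[OF C] Cx k by (metis diff_ge_0_iff_ge)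
    have "k + d \<in> S"
      using d(2) Cx by (fastforce simp: S_def algebra_simps)
    then have "k + d \<le> k" unfolding k_def using bdd by (rule cSup_upper)
    then show False using d(1) by simp
  qed
  then show thesis using that k by blast
qed

section \<open>Real spectra and the list of singular values\<close>

text \<open>Splitting an eigenvector into real and imaginary parts \<open>x\<close> and
  \<open>y\<close> gives two real equations. Pairing them crosswise, symmetry of \<open>B\<close>
  leaves \<open>Im l * (x \<bullet> x + y \<bullet> y) = 0\<close>.\<close>

lemma symmetric_mat_complex_eigenvalue_real:
  fixes B :: "real mat"
  assumes B: "B \<in> carrier_mat n n" and sym: "B\<^sup>T = B"
    and ev: "eigenvalue (map_mat complex_of_real B) l"
  shows "l \<in> \<real>"
proof -
  obtain v where v: "v \<in> carrier_vec n" "v \<noteq> 0\<^sub>v n"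
    and Bv: "map_mat complex_of_real B *\<^sub>v v = l \<cdot>\<^sub>v v"
    using ev B by (auto simp: eigenvalue_def eigenvector_def)
  define x y where "x = map_vec Re v" and "y = map_vec Im v"
  have xy: "x \<in> carrier_vec n" "y \<in> carrier_vec n" using v by (auto simp: x_def y_def)
  have comp: "(\<Sum>s<n. complex_of_real (B $$ (r, s)) * v $ s) = l * v $ r" if "r < n" for r
    using arg_cong[OF Bv, of "\<lambda>u. u $ r"] that B v
    by (simp add: scalar_prod_def lessThan_atLeast0)
  have Bx: "B *\<^sub>v x = Re l \<cdot>\<^sub>v x - Im l \<cdot>\<^sub>v y"
  proof (rule eq_vecI)
    fix r assume "r < dim_vec (Re l \<cdot>\<^sub>v x - Im l \<cdot>\<^sub>v y)"
    then have r: "r < n" using xy by simp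
    show "(B *\<^sub>v x) $ r = (Re l \<cdot>\<^sub>v x - Im l \<cdot>\<^sub>v y) $ r"
      using arg_cong[OF comp[OF r], of Re] r B v
      by (simp add: scalar_prod_def lessThan_atLeast0 x_def y_def)
  qed (use B xy in auto)
  have By: "B *\<^sub>v y = Re l \<cdot>\<^sub>v y + Im l \<cdot>\<^sub>v x"
  proof (rule eq_vecI)
    fix r assume "r < dim_vec (Re l \<cdot>\<^sub>v y + Im l \<cdot>\<^sub>v x)"
    then have r: "r < n" using xy by simp
    show "(B *\<^sub>v y) $ r = (Re l \<cdot>\<^sub>v y + Im l \<cdot>\<^sub>v x) $ r"
      using arg_cong[OF comp[OF r], of Im] r B v
      by (simp add: scalar_prod_def lessThan_atLeast0 x_def y_def)
  qed (use B xy in auto)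
  have "y \<bullet> (B *\<^sub>v x) = x \<bullet> (B *\<^sub>v y)"
    by (rule symmetric_mat_scalar_prod[OF B sym xy(2,1)])
  then have "Re l * (y \<bullet> x) - Im l * (y \<bullet> y) = Re l * (x \<bullet> y) + Im l * (x \<bullet> x)"
    using xy unfolding Bx By
    by (simp add: scalar_prod_add_distrib[of _ n] scalar_prod_minus_distrib[of _ n])
  then have "Im l * (x \<bullet> x + y \<bullet> y) = 0"
    using comm_scalar_prod[OF xy] by (simp add: algebra_simps)
  moreover have "x \<bullet> x + y \<bullet> y > 0"
  proof -
    have "x \<noteq> 0\<^sub>v n \<or> y \<noteq> 0\<^sub>v n"
    proof (rule ccontr)
      assume "\<not> ?thesis"
      then have "map_vec Re v = 0\<^sub>v n" "map_vec Im v = 0\<^sub>v n" by (auto simp: x_def y_def)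
      then have "v $ r = 0" if "r < n" for r
        using that v(1) by (metis carrier_vecD complex_eqI index_map_vec(1) index_zero_vec(1) zero_complex.simps)
      then show False using v by (auto intro!: eq_vecI)
    qed
    then show ?thesis
      using scalar_prod_self_pos xy scalar_prod_self_ge_0[of x] scalar_prod_self_ge_0[of y]
      by (metis add_pos_nonneg add_nonneg_pos)
  qed
  ultimately show ?thesis by (simp add: complex_is_Real_iff)
qed

text \<open>The fundamental theorem of algebra supplies a complex root, which is real by assumption,
  so a linear factor splits off over the reals and the degree drops by one.\<close>

lemma size_proots_real_rooted:
  fixes P :: "real poly"
  assumes "P \<noteq> 0" "\<And>z. poly (map_poly complex_of_real P) z = 0 \<Longrightarrow> z \<in> \<real>"
  shows "size (proots P) = degree P"
  using assms
proof (induction "degree P" arbitrary: P)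
  case 0
  then show ?case using size_proots_le[of P] by simp
next
  case (Suc d)
  have "\<not> constant (poly (map_poly complex_of_real P))"
    using Suc(2) by (simp add: constant_degree)
  then obtain z where z: "poly (map_poly complex_of_real P) z = 0"
    using fundamental_theorem_of_algebra by blast
  then obtain a where a: "z = complex_of_real a" using Suc.prems(2) by (auto elim: Reals_cases)
  then have "poly P a = 0" using z by simp
  then obtain R where R: "P = [:- a, 1:] * R" by (auto simp: poly_eq_0_iff_dvd)
  have "R \<noteq> 0" using R Suc.prems(1) by auto
  then have deg: "degree P = Suc (degree R)" using R by (simp add: degree_mult_eq del: mult_pCons_left)
  have "size (proots R) = degree R"
  proof (rule Suc.hyps(1))
    show "d = degree R" using deg Suc(2) by simp
    show "u \<in> \<real>" if "poly (map_poly complex_of_real R) u = 0" for u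
    proof (rule Suc.prems(2))
      have "map_poly complex_of_real P =
          map_poly complex_of_real [:- a, 1:] * map_poly complex_of_real R"
        unfolding R by (intro poly_eqI)
            (simp add: coeff_map_poly coeff_mult del: mult_pCons_left map_poly_pCons)
      then show "poly (map_poly complex_of_real P) u = 0" using that by simp
    qed
  qed fact
  then show ?case
    using \<open>R \<noteq> 0\<close> deg unfolding R by (simp add: proots_mult del: mult_pCons_left)
qed

text \<open>This fixes the length of the list of singular values: \<open>sigma n G\<close> reads
  position \<open>n - 1\<close>, which must exist and be the last one.\<close>

lemma symmetric_mat_size_proots_char_poly:
  fixes B :: "real mat"
  assumes B: "B \<in> carrier_mat n n" and sym: "B\<^sup>T = B"
  shows "size (proots (char_poly B)) = n"
proof -
  have "z \<in> \<real>" if "poly (map_poly complex_of_real (char_poly B)) z = 0" for z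
    using that symmetric_mat_complex_eigenvalue_real[OF B sym]
      eigenvalue_root_char_poly[of "map_mat complex_of_real B" n] B
    by (simp add: of_real_hom.char_poly_hom[OF B])
  then show ?thesis
    using size_proots_real_rooted[of "char_poly B"] degree_monic_char_poly[OF B]
    by fastforce
qed

lemma scalar_prod_gram:
  fixes G :: "real mat"
  assumes "G \<in> carrier_mat k n" "x \<in> carrier_vec n"
  shows "x \<bullet> ((G\<^sup>T * G) *\<^sub>v x) = (G *\<^sub>v x) \<bullet> (G *\<^sub>v x)"
proof -
  have "x \<bullet> ((G\<^sup>T * G) *\<^sub>v x) = x \<bullet> (G\<^sup>T *\<^sub>v (G *\<^sub>v x))"
    using assms by (subst assoc_mult_mat_vec[of _ n k _ n]) auto
  also have "\<dots> = (G\<^sup>T *\<^sub>v (G *\<^sub>v x)) \<bullet> x"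
    using assms by (intro comm_scalar_prod[of _ n]) auto
  also have "\<dots> = (G *\<^sub>v x) \<bullet> (G *\<^sub>v x)"
    using assms by (intro transpose_vec_mult_scalar) auto
  finally show ?thesis .
qed

text \<open>The eigenvalue \<open>l\<close> of the Gram matrix bounds its Rayleigh quotient from
  below, and \<open>sqrt l\<close> is in the list of singular values. The smallest list entry is
  therefore at most \<open>sqrt l\<close>, and this one inequality suffices.\<close>

lemma sigma_min_le:
  fixes G :: "real mat"
  assumes G: "G \<in> carrier_mat k n" and n: "n > 0" and x: "x \<in> carrier_vec n"
  shows "sigma n G * vnorm x \<le> vnorm (G *\<^sub>v x)"
proof -
  define B where "B = G\<^sup>T * G"
  have B: "B \<in> carrier_mat n n" using G by (simp add: B_def)
  have sym: "B\<^sup>T = B"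
    using G by (simp add: B_def transpose_mult[of _ n k _ n])
  obtain l where l: "eigenvalue B l" "\<And>x. x \<in> carrier_vec n \<Longrightarrow> l * (x \<bullet> x) \<le> x \<bullet> (B *\<^sub>v x)"
    using symmetric_mat_min_eigenvalue[OF B sym n] by blast
  have nz: "char_poly B \<noteq> 0"
    using degree_monic_char_poly[OF B] by auto
  define M where "M = image_mset sqrt (proots (char_poly B))"
  define L where "L = sorted_list_of_multiset M"
  have mset: "mset L = M" by (simp add: L_def)
  have len: "length L = n"
    using symmetric_mat_size_proots_char_poly[OF B sym] by (simp add: L_def M_def flip: size_mset)
  have "sqrt l \<in># M"
    using l(1) nz eigenvalue_root_char_poly[OF B] by (auto simp: M_def)
  then obtain i where i: "i < length L" "L ! i = sqrt l"
    using mset by (metis in_set_conv_nth set_mset_mset)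
  \<comment> \<open>The last entry of the decreasing list is the first entry of the increasing list
    \<open>L\<close>.\<close>
  have "sigma n G = L ! 0"
    using len n by (simp add: sigma_def singular_values_def L_def M_def B_def rev_nth)
  also have "\<dots> \<le> sqrt l"
    using i sorted_nth_mono[of L 0 i] by (simp add: L_def)
  finally have "sigma n G * vnorm x \<le> sqrt l * vnorm x"
    by (intro mult_right_mono) (auto simp: vnorm_def scalar_prod_self_ge_0)
  \<comment> \<open>\<open>sqrt\<close> is extended to the negative reals as an odd function, so it
    is multiplicative and monotone everywhere and the sign of \<open>l\<close> does not
    matter.\<close>
  also have "\<dots> = sqrt (l * (x \<bullet> x))" by (simp add: vnorm_def real_sqrt_mult)
  also have "\<dots> \<le> vnorm (G *\<^sub>v x)"
    using l(2)[OF x] scalar_prod_gram[OF G x] by (simp add: vnorm_def B_def)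
  finally show ?thesis .
qed

subsection \<open>Hessenberg least-squares problems\<close>

lemma vnorm_L2_set: "vnorm v = L2_set (($) v) {..<dim_vec v}"
  by (simp add: vnorm_def L2_set_def scalar_prod_def power2_eq_square lessThan_atLeast0)

lemma vnorm_ge_0 [simp]: "0 \<le> vnorm v"
  by (simp add: vnorm_L2_set)

lemma vnorm_power2: "(vnorm v)\<^sup>2 = v \<bullet> v"
  by (simp add: vnorm_def scalar_prod_def sum_nonneg)

lemma vnorm_smult: "vnorm (a \<cdot>\<^sub>v v) = \<bar>a\<bar> * vnorm v"
  by (simp add: vnorm_def real_sqrt_mult mult.assoc[symmetric])

lemma vnorm_uminus: "vnorm (- v) = vnorm v"
  by (simp add: vnorm_def)

lemma abs_index_le_vnorm: "k < dim_vec v \<Longrightarrow> \<bar>v $ k\<bar> \<le> vnorm v"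
  unfolding vnorm_L2_set L2_set_def
  by (intro real_le_rsqrt) (simp add: member_le_sum[of k "{..<dim_vec v}" "\<lambda>i. (v $ i)\<^sup>2"])

lemma L2_set_sum_le: "L2_set (\<lambda>r. \<Sum>s<i::nat. f s r) A \<le> (\<Sum>s<i. L2_set (f s) A)"
proof (induction i)
  case (Suc i)
  then show ?case
    using L2_set_triangle_ineq[of "\<lambda>r. \<Sum>s<i. f s r" "f i" A] by simp
qed (simp add: L2_set_def)

lemma cols_upto_carrier [simp]: "cols_upto N x i \<in> carrier_mat N i"
  by (rule carrier_matI) (simp_all add: cols_upto_def del: upt_Suc)

lemma dim_cols_upto [simp]: "dim_row (cols_upto N x i) = N" "dim_col (cols_upto N x i) = i"
  by (simp_all add: cols_upto_def del: upt_Suc)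

text \<open>The shift by \<open>Suc\<close> recurs in all sums below: matrix positions start at 0,
  the sequences of the iteration at 1.\<close>

lemma index_cols_upto [simp]:
  "r < N \<Longrightarrow> s < i \<Longrightarrow> cols_upto N x i $$ (r, s) = x (Suc s) $ r"
  by (simp add: cols_upto_def mat_of_cols_index del: upt_Suc)

lemma col_cols_upto:
  "s < i \<Longrightarrow> x (Suc s) \<in> carrier_vec N \<Longrightarrow> col (cols_upto N x i) s = x (Suc s)"
  by (auto intro!: eq_vecI)

lemma index_cols_upto_mult:
  "r < N \<Longrightarrow> u \<in> carrier_vec i \<Longrightarrow> (cols_upto N x i *\<^sub>v u) $ r = (\<Sum>s<i. x (Suc s) $ r * u $ s)"
  by (simp add: scalar_prod_def lessThan_atLeast0)

text \<open>Keeping the columns apart in the triangle inequality lets a large inner residual be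
  compensated by a small coefficient.\<close>

lemma vnorm_cols_upto_mult_le:
  assumes "u \<in> carrier_vec i" "\<And>s. s < i \<Longrightarrow> x (Suc s) \<in> carrier_vec N"
  shows "vnorm (cols_upto N x i *\<^sub>v u) \<le> (\<Sum>s<i. vnorm (x (Suc s)) * \<bar>u $ s\<bar>)"
proof -
  have "vnorm (cols_upto N x i *\<^sub>v u) = L2_set (\<lambda>r. \<Sum>s<i. x (Suc s) $ r * u $ s) {..<N}"
    unfolding vnorm_L2_set using assms(1)
    by (intro L2_set_cong) (auto simp: index_cols_upto_mult simp del: index_mult_mat_vec)
  also have "\<dots> \<le> (\<Sum>s<i. L2_set (\<lambda>r. x (Suc s) $ r * u $ s) {..<N})"
    by (rule L2_set_sum_le)
  also have "\<dots> = (\<Sum>s<i. vnorm (x (Suc s)) * \<bar>u $ s\<bar>)"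
  proof (rule sum.cong)
    fix s assume "s \<in> {..<i}"
    then have "dim_vec (x (Suc s)) = N" using assms(2) by auto
    then show "L2_set (\<lambda>r. x (Suc s) $ r * u $ s) {..<N} = vnorm (x (Suc s)) * \<bar>u $ s\<bar>"
      by (simp add: vnorm_L2_set L2_set_def power_mult_distrib real_sqrt_mult
          flip: sum_distrib_right)
  qed simp
  finally show ?thesis .
qed

lemma scalar_prod_cols_upto_mult:
  assumes "u \<in> carrier_vec i" "y \<in> carrier_vec N" "\<And>s. s < i \<Longrightarrow> x (Suc s) \<in> carrier_vec N"
  shows "y \<bullet> (cols_upto N x i *\<^sub>v u) = (\<Sum>s<i. (x (Suc s) \<bullet> y) * u $ s)"
proof -
  have "y \<bullet> (cols_upto N x i *\<^sub>v u) = ((cols_upto N x i)\<^sup>T *\<^sub>v y) \<bullet> u"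
    using assms by (intro transpose_vec_mult_scalar[symmetric]) auto
  then show ?thesis
    using assms by (simp add: scalar_prod_def[of _ u] col_cols_upto lessThan_atLeast0)
qed

text \<open>Pairing the product with a column recovers a coordinate of \<open>u\<close>. The lemma
  carries the norms of the exact residuals over to the small least-squares problems.\<close>

lemma vnorm_cols_upto_mult_orthonormal:
  assumes u: "u \<in> carrier_vec i" and x: "\<And>s. s < i \<Longrightarrow> x (Suc s) \<in> carrier_vec N"
    and orth: "\<And>s t. s < i \<Longrightarrow> t < i \<Longrightarrow> x (Suc s) \<bullet> x (Suc t) = (if s = t then 1 else 0)"
  shows "vnorm (cols_upto N x i *\<^sub>v u) = vnorm u"
proof -
  let ?y = "cols_upto N x i *\<^sub>v u"
  have y: "?y \<in> carrier_vec N" by (rule carrier_vecI) simp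
  have "x (Suc s) \<bullet> ?y = u $ s" if "s < i" for s
  proof -
    have "x (Suc s) \<bullet> ?y = (\<Sum>t<i. (x (Suc t) \<bullet> x (Suc s)) * u $ t)"
      using that by (intro scalar_prod_cols_upto_mult u x)
    also have "\<dots> = (\<Sum>t<i. (if s = t then u $ t else 0))"
      using that by (intro sum.cong) (auto simp: orth)
    finally show ?thesis using that by simp
  qed
  moreover have "?y \<bullet> ?y = (\<Sum>s<i. (x (Suc s) \<bullet> ?y) * u $ s)"
    by (intro scalar_prod_cols_upto_mult u x y)
  ultimately have "?y \<bullet> ?y = u \<bullet> u"
    using u by (simp add: scalar_prod_def[of u] lessThan_atLeast0)
  then show ?thesis by (simp add: vnorm_def)
qed

lemma hessenberg_carrier [simp]: "hessenberg h \<beta> i \<in> carrier_mat (Suc i) i"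
  by (induction i) (auto simp: mat_of_cols_def)

lemma dim_hessenberg [simp]: "dim_row (hessenberg h \<beta> i) = Suc i" "dim_col (hessenberg h \<beta> i) = i"
  using hessenberg_carrier[of h \<beta> i] by (auto simp del: hessenberg_carrier)

text \<open>The right-hand side does not depend on \<open>i\<close>: earlier Hessenberg matrices are
  leading submatrices of later ones, which is what zero padding relies on.\<close>

lemma index_hessenberg:
  "r \<le> i \<Longrightarrow> s < i \<Longrightarrow> hessenberg h \<beta> i $$ (r, s) =
     (if r \<le> s then h (Suc s) $ r else if r = Suc s then \<beta> (Suc s) else 0)"
proof (induction i)
  case (Suc i)
  then show ?case
    by (cases "s = i") (auto simp: less_Suc_eq_le mat_of_cols_index)
qed simp

lemma shifted_hessenberg_carrier [simp]:
  "I_under i - \<mu> \<cdot>\<^sub>m hessenberg h \<beta> i \<in> carrier_mat (Suc i) i"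
  by (rule carrier_matI) (simp_all add: I_under_def)

lemma index_shifted_hessenberg:
  "r \<le> i \<Longrightarrow> s < i \<Longrightarrow> (I_under i - \<mu> \<cdot>\<^sub>m hessenberg h \<beta> i) $$ (r, s) =
     (if r = s then 1 else 0) -
     \<mu> * (if r \<le> s then h (Suc s) $ r else if r = Suc s then \<beta> (Suc s) else 0)"
  by (simp add: I_under_def index_hessenberg)

text \<open>The zeros of \<open>pad\<close> switch off the columns from \<open>i\<close> on. The
  remaining columns agree with the smaller matrix in rows up to \<open>i\<close> and vanish below.
  The case \<open>i = 0\<close> is included and covers the initial residual.\<close>

lemma shifted_hessenberg_residual_pad:
  assumes u: "u \<in> carrier_vec i" and ij: "i \<le> j"
  defines "pad \<equiv> vec j (\<lambda>s. if s < i then u $ s else 0)"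
  shows "vnorm (a \<cdot>\<^sub>v unit_vec (j + 1) 0 - (I_under j - \<mu> \<cdot>\<^sub>m hessenberg h \<beta> j) *\<^sub>v pad) =
    vnorm (a \<cdot>\<^sub>v unit_vec (i + 1) 0 - (I_under i - \<mu> \<cdot>\<^sub>m hessenberg h \<beta> i) *\<^sub>v u)"
    (is "vnorm ?x = vnorm ?y")
proof -
  have pad: "pad \<in> carrier_vec j" by (simp add: pad_def)
  have mult: "((I_under j - \<mu> \<cdot>\<^sub>m hessenberg h \<beta> j) *\<^sub>v pad) $ r =
      (\<Sum>s<i. (I_under j - \<mu> \<cdot>\<^sub>m hessenberg h \<beta> j) $$ (r, s) * u $ s)" if "r \<le> j" for r
  proof -
    have "((I_under j - \<mu> \<cdot>\<^sub>m hessenberg h \<beta> j) *\<^sub>v pad) $ r =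
        (\<Sum>s<j. (I_under j - \<mu> \<cdot>\<^sub>m hessenberg h \<beta> j) $$ (r, s) * pad $ s)"
      using that pad by (simp add: scalar_prod_def lessThan_atLeast0 I_under_def)
    also have "\<dots> = (\<Sum>s<i. (I_under j - \<mu> \<cdot>\<^sub>m hessenberg h \<beta> j) $$ (r, s) * pad $ s)"
      using ij by (intro sum.mono_neutral_right) (auto simp: pad_def)
    also have "\<dots> = (\<Sum>s<i. (I_under j - \<mu> \<cdot>\<^sub>m hessenberg h \<beta> j) $$ (r, s) * u $ s)"
      using ij by (intro sum.cong) (auto simp: pad_def)
    finally show ?thesis .
  qed
  have top: "?x $ r = ?y $ r" if "r \<le> i" for r
  proof -
    have "((I_under i - \<mu> \<cdot>\<^sub>m hessenberg h \<beta> i) *\<^sub>v u) $ r =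
        (\<Sum>s<i. (I_under i - \<mu> \<cdot>\<^sub>m hessenberg h \<beta> i) $$ (r, s) * u $ s)"
      using that u by (simp add: scalar_prod_def lessThan_atLeast0 I_under_def)
    also have "\<dots> = (\<Sum>s<i. (I_under j - \<mu> \<cdot>\<^sub>m hessenberg h \<beta> j) $$ (r, s) * u $ s)"
      using that ij by (intro sum.cong) (auto simp: index_shifted_hessenberg simp del: index_minus_mat)
    finally show ?thesis
      using that ij mult[of r] by (simp add: unit_vec_def I_under_def)
  qed
  have bottom: "?x $ r = 0" if "i < r" "r \<le> j" for r
  proof -
    have "((I_under j - \<mu> \<cdot>\<^sub>m hessenberg h \<beta> j) *\<^sub>v pad) $ r = 0"
      unfolding mult[OF that(2)] using that ij
      by (intro sum.neutral) (auto simp: index_shifted_hessenberg simp del: index_minus_mat)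
    then show ?thesis
      using that by (simp add: unit_vec_def I_under_def)
  qed
  have "(\<Sum>r<Suc j. (?x $ r)\<^sup>2) = (\<Sum>r<Suc i. (?x $ r)\<^sup>2)"
    using ij bottom by (intro sum.mono_neutral_right) auto
  also have "\<dots> = (\<Sum>r<Suc i. (?y $ r)\<^sup>2)"
    using top by (intro sum.cong) auto
  finally show ?thesis
    by (simp add: vnorm_L2_set L2_set_def I_under_def)
qed

text \<open>A least-squares residual is orthogonal to the range of \<open>G\<close>, hence Pythagoras applies.\<close>

lemma least_squares_error_le:
  fixes G :: "real mat"
  assumes G: "G \<in> carrier_mat k n" and g: "g \<in> carrier_vec k"
    and w: "is_arg_min (\<lambda>u. vnorm (G *\<^sub>v u - g)) (\<lambda>u. u \<in> carrier_vec n) w"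
    and u: "u \<in> carrier_vec n"
  shows "vnorm (G *\<^sub>v (w - u)) \<le> vnorm (g - G *\<^sub>v u)"
proof -
  have wc: "w \<in> carrier_vec n"
    and min: "\<And>v. v \<in> carrier_vec n \<Longrightarrow> vnorm (G *\<^sub>v w - g) \<le> vnorm (G *\<^sub>v v - g)"
    using w by (auto simp: is_arg_min_linorder)
  define a where "a = G *\<^sub>v w - g"
  define e where "e = G *\<^sub>v (w - u)"
  have ae: "a \<in> carrier_vec k" "e \<in> carrier_vec k"
    using G g wc u by (auto simp: a_def e_def)
  have expand: "(a - t \<cdot>\<^sub>v e) \<bullet> (a - t \<cdot>\<^sub>v e) = a \<bullet> a - 2 * t * (a \<bullet> e) + t * t * (e \<bullet> e)" for t
    using ae comm_scalar_prod[OF ae]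
    by (simp add: minus_scalar_prod_distrib[of _ k] scalar_prod_minus_distrib[of _ k] algebra_simps)
  \<comment> \<open>Subtracting multiples of \<open>e\<close> from the residual amounts to moving
    the coefficients from \<open>w\<close> towards \<open>u\<close>, so minimality applies for every
    \<open>t\<close>.\<close>
  have step: "a - t \<cdot>\<^sub>v e = G *\<^sub>v (w - t \<cdot>\<^sub>v (w - u)) - g" for t
    using G g wc u
    by (auto simp: a_def e_def mult_minus_distrib_mat_vec[of _ k n] mult_mat_vec[of _ k n])
  have quad: "0 \<le> - 2 * t * (a \<bullet> e) + t * t * (e \<bullet> e)" for t
  proof -
    have "(vnorm a)\<^sup>2 \<le> (vnorm (a - t \<cdot>\<^sub>v e))\<^sup>2"
      unfolding step using wc u by (simp add: a_def min power_mono)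
    then show ?thesis by (simp add: vnorm_power2 expand)
  qed
  \<comment> \<open>One half of the orthogonality is enough. If the product were positive, a short
    step towards \<open>u\<close> would beat the minimum; the 1 in the denominator of
    \<open>t\<close> keeps the step short and well defined.\<close>
  have "a \<bullet> e \<le> 0"
  proof (rule ccontr)
    assume pos: "\<not> a \<bullet> e \<le> 0"
    define t where "t = (a \<bullet> e) / (1 + e \<bullet> e)"
    have den: "1 + e \<bullet> e > 0" using scalar_prod_self_ge_0[of e] by linarith
    then have t: "t > 0" using pos by (simp add: t_def)
    have "t * (e \<bullet> e) \<le> a \<bullet> e"
      using den pos t by (simp add: t_def field_simps)
    then have "t * (t * (e \<bullet> e)) \<le> t * (a \<bullet> e)" using t by (intro mult_left_mono) auto
    moreover have "t * (a \<bullet> e) > 0" using t pos by simp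
    ultimately show False using quad[of t] by (simp add: mult.assoc)
  qed
  \<comment> \<open>The full step \<open>t = 1\<close> arrives at \<open>u\<close>; the factor 1 is
    kept so that \<open>step\<close> and \<open>expand\<close> apply.\<close>
  have "g - G *\<^sub>v u = - (a - 1 \<cdot>\<^sub>v e)"
    unfolding step using G g wc u by (intro eq_vecI) (auto simp: mult_minus_distrib_mat_vec[of _ k n])
  then have "(vnorm (g - G *\<^sub>v u))\<^sup>2 = (a - 1 \<cdot>\<^sub>v e) \<bullet> (a - 1 \<cdot>\<^sub>v e)"
    by (simp add: vnorm_uminus vnorm_power2)
  also have "\<dots> = a \<bullet> a - 2 * (a \<bullet> e) + e \<bullet> e" unfolding expand by simp
  also have "\<dots> \<ge> (vnorm e)\<^sup>2"
    using \<open>a \<bullet> e \<le> 0\<close> scalar_prod_self_ge_0[of a] by (simp add: vnorm_power2)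
  finally show ?thesis unfolding e_def by (rule power2_le_imp_le) simp
qed

subsection \<open>The inexact Arnoldi process\<close>

lemma inexact_infinite_gmres_step:
  assumes "inexact_infinite_gmres Kinv M c j q z h \<beta>" "i \<in> {1..j}"
  shows "z i = Kinv i *\<^sub>v q i"
    and "h i = (cols_upto (dim_vec c) q i)\<^sup>T *\<^sub>v (M *\<^sub>v z i)"
    and "\<beta> i = vnorm (M *\<^sub>v z i - cols_upto (dim_vec c) q i *\<^sub>v h i)"
    and "\<beta> i \<noteq> 0"
    and "q (Suc i) = (1 / \<beta> i) \<cdot>\<^sub>v (M *\<^sub>v z i - cols_upto (dim_vec c) q i *\<^sub>v h i)"
  using assms unfolding inexact_infinite_gmres_def Let_def Suc_eq_plus1 by blast+

lemma inexact_infinite_gmres_q_carrier: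
  assumes run: "inexact_infinite_gmres Kinv M c j q z h \<beta>" and c: "c \<in> carrier_vec N"
    and s: "s \<le> j"
  shows "q (Suc s) \<in> carrier_vec N"
proof (cases s)
  case 0
  then show ?thesis using run c by (auto simp: inexact_infinite_gmres_def)
next
  case (Suc i)
  then show ?thesis
    using inexact_infinite_gmres_step(5)[OF run, of s] s c Suc by (auto intro: carrier_vecI)
qed

text \<open>Induction along the Gram-Schmidt process: \<open>h\<close> collects the inner products
  of \<open>y\<close> with the earlier vectors, so by their orthonormality subtracting
  \<open>Q *\<^sub>v h\<close> removes exactly these components. The inexactness of \<open>z\<close>
  has no influence on this.\<close>

lemma inexact_infinite_gmres_orthonormal:
  assumes run: "inexact_infinite_gmres Kinv M c j q z h \<beta>"
    and c: "c \<in> carrier_vec N" "c \<noteq> 0\<^sub>v N" and M: "M \<in> carrier_mat N N"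
  shows "s \<le> j \<Longrightarrow> t \<le> j \<Longrightarrow> q (Suc s) \<bullet> q (Suc t) = (if s = t then 1 else 0)"
proof -
  note q = inexact_infinite_gmres_q_carrier[OF run c(1)]
  have "\<forall>s\<le>i. \<forall>t\<le>i. q (Suc s) \<bullet> q (Suc t) = (if s = t then 1 else 0)" if "i \<le> j" for i
    using that
  proof (induction i)
    case 0
    have "vnorm c \<noteq> 0" using scalar_prod_self_pos[OF c] by (simp add: vnorm_def)
    moreover have "q 1 = (1 / vnorm c) \<cdot>\<^sub>v c" using run by (simp add: inexact_infinite_gmres_def)
    ultimately have "q 1 \<bullet> q 1 = 1"
      using vnorm_power2[of c, symmetric] by (simp add: power2_eq_square)
    then show ?case by simp
  next
    case (Suc i)
    define y where "y = M *\<^sub>v z (Suc i)"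
    define Q where "Q = cols_upto N q (Suc i)"
    define yp where "yp = y - Q *\<^sub>v h (Suc i)"
    have i: "Suc i \<in> {1..j}" using Suc.prems by simp
    note step = inexact_infinite_gmres_step[OF run i]
    have dim: "dim_vec c = N" using c by simp
    have y: "y \<in> carrier_vec N" using M by (auto simp: y_def intro: carrier_vecI)
    have h: "h (Suc i) = Q\<^sup>T *\<^sub>v y" using step(2) by (simp add: dim y_def Q_def)
    have hc: "h (Suc i) \<in> carrier_vec (Suc i)" unfolding h by (rule carrier_vecI) (simp add: Q_def)
    have yp: "yp \<in> carrier_vec N" by (rule carrier_vecI) (simp add: yp_def Q_def)
    have \<beta>: "\<beta> (Suc i) = vnorm yp" "\<beta> (Suc i) \<noteq> 0"
      using step(3,4) by (simp_all add: dim yp_def y_def Q_def)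
    have qn: "q (Suc (Suc i)) = (1 / \<beta> (Suc i)) \<cdot>\<^sub>v yp"
      using step(5) by (simp add: dim yp_def y_def Q_def)
    have orth: "q (Suc s) \<bullet> yp = 0" if s: "s \<le> i" for s
    proof -
      have qs: "q (Suc s) \<in> carrier_vec N" using q s Suc.prems by simp
      have "q (Suc s) \<bullet> (Q *\<^sub>v h (Suc i)) = (\<Sum>t<Suc i. (q (Suc t) \<bullet> q (Suc s)) * h (Suc i) $ t)"
        unfolding Q_def using Suc.prems
        by (intro scalar_prod_cols_upto_mult hc qs q) simp
      also have "\<dots> = (\<Sum>t<Suc i. if s = t then h (Suc i) $ t else 0)"
        using Suc.IH Suc.prems s by (intro sum.cong) auto
      also have "\<dots> = h (Suc i) $ s" using s by (simp del: sum.lessThan_Suc)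
      also have "\<dots> = q (Suc s) \<bullet> y"
        using s q[of s] Suc.prems unfolding h by (simp add: Q_def col_cols_upto)
      finally show ?thesis
        using qs y unfolding yp_def
        by (subst scalar_prod_minus_distrib[of _ N]) (auto simp: Q_def intro: carrier_vecI)
    qed
    have "q (Suc (Suc i)) \<bullet> q (Suc (Suc i)) = 1"
      using \<beta> vnorm_power2[of yp, symmetric] unfolding qn by (simp add: power2_eq_square)
    moreover have "q (Suc s) \<bullet> q (Suc (Suc i)) = 0" "q (Suc (Suc i)) \<bullet> q (Suc s) = 0" if "s \<le> i" for s
    proof -
      have qs: "q (Suc s) \<in> carrier_vec N" using q that Suc.prems by simp
      show "q (Suc s) \<bullet> q (Suc (Suc i)) = 0"
        unfolding qn using qs yp orth[OF that] by simp
      then show "q (Suc (Suc i)) \<bullet> q (Suc s) = 0"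
        using comm_scalar_prod[OF qs q[of "Suc i"]] Suc.prems by simp
    qed
    ultimately show ?case using Suc by (auto simp: le_Suc_eq)
  qed
  then show "s \<le> j \<Longrightarrow> t \<le> j \<Longrightarrow> q (Suc s) \<bullet> q (Suc t) = (if s = t then 1 else 0)"
    by blast
qed

text \<open>Columnwise this is the Gram-Schmidt step solved for \<open>M *\<^sub>v z i\<close>,
  which is possible because \<beta> is nonzero.\<close>

lemma inexact_infinite_gmres_arnoldi:
  assumes run: "inexact_infinite_gmres Kinv M c j q z h \<beta>"
    and c: "c \<in> carrier_vec N" and M: "M \<in> carrier_mat N N"
    and z: "\<And>i. i \<in> {1..j} \<Longrightarrow> z i \<in> carrier_vec N"
  shows "M * cols_upto N z j = cols_upto N q (Suc j) * hessenberg h \<beta> j"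
proof (rule eq_matI)
  fix r s
  assume "r < dim_row (cols_upto N q (Suc j) * hessenberg h \<beta> j)"
    and "s < dim_col (cols_upto N q (Suc j) * hessenberg h \<beta> j)"
  then have r: "r < N" and s: "s < j" by simp_all
  have i: "Suc s \<in> {1..j}" using s by simp
  note step = inexact_infinite_gmres_step[OF run i]
  have dim: "dim_vec c = N" using c by simp
  have hc: "h (Suc s) \<in> carrier_vec (Suc s)" unfolding step(2) by (rule carrier_vecI) simp
  have q: "\<beta> (Suc s) * q (Suc (Suc s)) $ r =
      (M *\<^sub>v z (Suc s)) $ r - (cols_upto N q (Suc s) *\<^sub>v h (Suc s)) $ r"
    using step(4) r M unfolding step(5) dim by simp
  have "(M * cols_upto N z j) $$ (r, s) = (M *\<^sub>v z (Suc s)) $ r"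
    using r s M z[OF i] by (simp add: col_cols_upto)
  also have "\<dots> = (\<Sum>t<Suc s. q (Suc t) $ r * h (Suc s) $ t) + q (Suc (Suc s)) $ r * \<beta> (Suc s)"
    using q index_cols_upto_mult[OF r hc, of q] by (simp add: mult.commute)
  also have "\<dots> = (\<Sum>t<Suc (Suc s). q (Suc t) $ r * hessenberg h \<beta> j $$ (t, s))"
    using s by (simp add: index_hessenberg)
  \<comment> \<open>Column \<open>s\<close> vanishes below the subdiagonal, so the sum may run over
    all rows.\<close>
  also have "\<dots> = (\<Sum>t<Suc j. q (Suc t) $ r * hessenberg h \<beta> j $$ (t, s))"
    using s by (intro sum.mono_neutral_left) (auto simp: index_hessenberg)
  also have "\<dots> = (cols_upto N q (Suc j) * hessenberg h \<beta> j) $$ (r, s)"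
    using r s by (simp add: scalar_prod_def lessThan_atLeast0)
  finally show "(M * cols_upto N z j) $$ (r, s) = (cols_upto N q (Suc j) * hessenberg h \<beta> j) $$ (r, s)" .
qed (use M in auto)

lemma cols_upto_mult_I_under: "cols_upto N x (Suc i) * I_under i = cols_upto N x i"
proof (rule eq_matI)
  fix r s assume "r < dim_row (cols_upto N x i)" "s < dim_col (cols_upto N x i)"
  then have rs: "r < N" "s < i" by simp_all
  have "(cols_upto N x (Suc i) * I_under i) $$ (r, s) =
      (\<Sum>t<Suc i. if t = s then x (Suc t) $ r else 0)"
    using rs by (simp add: I_under_def scalar_prod_def lessThan_atLeast0 if_distrib cong: if_cong
        del: sum.op_ivl_Suc)
  then show "(cols_upto N x (Suc i) * I_under i) $$ (r, s) = cols_upto N x i $$ (r, s)"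
    using rs by (simp del: sum.lessThan_Suc)
qed (auto simp: I_under_def)

text \<open>With the inner residuals as columns of \<open>P\<close>, three identities do the work:
  \<open>K * Z = Q * I + P\<close>, \<open>M * Z = Q * H\<close>, and \<open>Q\<close> maps the
  scaled first unit vector to \<open>c\<close>. Everything but \<open>P *\<^sub>v u\<close>
  cancels.\<close>

lemma inexact_infinite_gmres_residual_gap:
  assumes run: "inexact_infinite_gmres Kinv M c j q z h \<beta>"
    and c: "c \<in> carrier_vec N" "c \<noteq> 0\<^sub>v N"
    and M: "M \<in> carrier_mat N N" and K: "K \<in> carrier_mat N N"
    and z: "\<And>i. i \<in> {1..j} \<Longrightarrow> z i \<in> carrier_vec N"
    and p: "\<And>i. i \<in> {1..j} \<Longrightarrow> p i = K *\<^sub>v z i - q i"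
    and u: "u \<in> carrier_vec j"
  shows "c - (K - \<mu> \<cdot>\<^sub>m M) *\<^sub>v (cols_upto N z j *\<^sub>v u) -
      cols_upto N q (Suc j) *\<^sub>v
        (vnorm c \<cdot>\<^sub>v unit_vec (j + 1) 0 - (I_under j - \<mu> \<cdot>\<^sub>m hessenberg h \<beta> j) *\<^sub>v u) =
    - (cols_upto N p j *\<^sub>v u)"
proof -
  define Q where "Q = cols_upto N q (Suc j)"
  define H where "H = hessenberg h \<beta> j"
  define Z where "Z = cols_upto N z j"
  define P where "P = cols_upto N p j"
  define I where "I = I_under j"
  have car: "Q \<in> carrier_mat N (Suc j)" "H \<in> carrier_mat (Suc j) j" "Z \<in> carrier_mat N j"
    "P \<in> carrier_mat N j" "I \<in> carrier_mat (Suc j) j"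
    by (simp_all add: Q_def H_def Z_def P_def I_def I_under_def)
  note q = inexact_infinite_gmres_q_carrier[OF run c(1)]
  have KZ: "K * Z = Q * I + P"
  proof (rule eq_matI)
    fix r s assume "r < dim_row (Q * I + P)" "s < dim_col (Q * I + P)"
    then have rs: "r < N" "s < j" using car by simp_all
    then show "(K * Z) $$ (r, s) = (Q * I + P) $$ (r, s)"
      using K z[of "Suc s"] q[of s] p[of "Suc s"]
      unfolding Q_def I_def cols_upto_mult_I_under Z_def P_def
      by (simp add: col_cols_upto)
  qed (use car K in auto)
  have MZ: "M * Z = Q * H"
    unfolding Z_def Q_def H_def by (rule inexact_infinite_gmres_arnoldi[OF run c(1) M z])
  have Qe: "Q *\<^sub>v (vnorm c \<cdot>\<^sub>v unit_vec (j + 1) 0) = c"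
  proof (rule eq_vecI)
    fix r assume "r < dim_vec c"
    then have r: "r < N" using c by simp
    have "vnorm c \<noteq> 0" using scalar_prod_self_pos[OF c] by (simp add: vnorm_def)
    moreover have "q 1 = (1 / vnorm c) \<cdot>\<^sub>v c" using run by (simp add: inexact_infinite_gmres_def)
    moreover have "(Q *\<^sub>v (vnorm c \<cdot>\<^sub>v unit_vec (j + 1) 0)) $ r = vnorm c * q 1 $ r"
      using r car by (simp add: mult_mat_vec[of _ N "Suc j"] Q_def)
    ultimately show "(Q *\<^sub>v (vnorm c \<cdot>\<^sub>v unit_vec (j + 1) 0)) $ r = c $ r"
      using r c by simp
  qed (use c car in auto)
  have KZu: "K *\<^sub>v (Z *\<^sub>v u) = Q *\<^sub>v (I *\<^sub>v u) + P *\<^sub>v u"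
  proof -
    have "K *\<^sub>v (Z *\<^sub>v u) = (Q * I + P) *\<^sub>v u"
      using assoc_mult_mat_vec[OF K car(3) u] KZ by simp
    then show ?thesis
      using car u by (simp add: add_mult_distrib_mat_vec[of _ N j])
  qed
  have MZu: "M *\<^sub>v (Z *\<^sub>v u) = Q *\<^sub>v (H *\<^sub>v u)"
    using assoc_mult_mat_vec[OF M car(3) u] assoc_mult_mat_vec[OF car(1,2) u] MZ by simp
  have smult: "(\<mu> \<cdot>\<^sub>m A) *\<^sub>v x = \<mu> \<cdot>\<^sub>v (A *\<^sub>v x)" if "A \<in> carrier_mat k l" "x \<in> carrier_vec l" for A x k l
    using that by (intro eq_vecI) (auto simp: smult_scalar_prod_distrib[of _ l])
  have "(K - \<mu> \<cdot>\<^sub>m M) *\<^sub>v (Z *\<^sub>v u) = K *\<^sub>v (Z *\<^sub>v u) - \<mu> \<cdot>\<^sub>v (M *\<^sub>v (Z *\<^sub>v u))"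
    using K M car u by (simp add: minus_mult_distrib_mat_vec[of _ N N] smult[of _ N N])
  moreover have "Q *\<^sub>v (vnorm c \<cdot>\<^sub>v unit_vec (j + 1) 0 - (I - \<mu> \<cdot>\<^sub>m H) *\<^sub>v u) =
      c - (Q *\<^sub>v (I *\<^sub>v u) - \<mu> \<cdot>\<^sub>v (Q *\<^sub>v (H *\<^sub>v u)))"
    using car u Qe
    by (simp add: minus_mult_distrib_mat_vec[of _ "Suc j" j] smult[of _ "Suc j" j]
        mult_minus_distrib_mat_vec[of _ N "Suc j"] mult_mat_vec[of _ N "Suc j"])
  ultimately show ?thesis
    using K M car u c(1) unfolding Q_def[symmetric] H_def[symmetric] Z_def[symmetric]
      P_def[symmetric] I_def[symmetric] KZu MZu
    by (intro eq_vecI) auto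
qed

section \<open>The bound on the residual gap\<close>

theorem proposition3p5:
  fixes n m j :: nat
    and A :: "nat \<Rightarrow> real mat"
    and A0inv :: "nat \<Rightarrow> real mat"
    and b c r v :: "real vec"
    and K M :: "real mat"
    and \<mu> \<epsilon> :: real
    and q z h w rt p :: "nat \<Rightarrow> real vec"
    and \<beta> :: "nat \<Rightarrow> real"
    and H Q Z :: "nat \<Rightarrow> real mat"
  assumes A_dim: "\<And>k. k \<le> m \<Longrightarrow> A k \<in> carrier_mat n n"
    and A0: "invertible_mat (A 0)"
    and b_dim: "b \<in> carrier_vec n"
    and b_nz: "b \<noteq> 0\<^sub>v n"
    and eps: "\<epsilon> > 0"
    and j_ge: "j \<ge> 1"
    and m_ge: "m \<ge> j"
    and K_eq: "K = K_mat n m A"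
    and M_eq: "M = M_mat n m"
    and c_eq: "c = c_vec n m b"
    and A0inv_dim: "\<And>i. i \<in> {1..j} \<Longrightarrow> A0inv i \<in> carrier_mat n n"
    and run: "inexact_infinite_gmres (\<lambda>i. K_inv_approx n m A (A0inv i)) M c j q z h \<beta>"
    and Q_eq: "\<And>i. Q i = cols_upto ((m + 1) * n) q i"
    and Z_eq: "\<And>i. Z i = cols_upto ((m + 1) * n) z i"
    and H_eq: "\<And>i. H i = hessenberg h \<beta> i"
    and w_min: "\<And>i. i \<in> {1..j} \<Longrightarrow>
      is_arg_min
        (\<lambda>u. vnorm ((I_under i - \<mu> \<cdot>\<^sub>m H i) *\<^sub>v u - vnorm c \<cdot>\<^sub>v unit_vec (i + 1) 0))
        (\<lambda>u. u \<in> carrier_vec i) (w i)"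
    and v_eq: "v = Z j *\<^sub>v w j"
    and r_eq: "r = c - (K - \<mu> \<cdot>\<^sub>m M) *\<^sub>v v"
    and rt_0: "rt 0 = c"
    and rt_eq: "\<And>i. i \<in> {1..j} \<Longrightarrow>
      rt i = Q (i + 1) *\<^sub>v
        (vnorm c \<cdot>\<^sub>v unit_vec (i + 1) 0 - (I_under i - \<mu> \<cdot>\<^sub>m H i) *\<^sub>v w i)"
    and rt_nz: "\<And>i. i \<in> {1..j} \<Longrightarrow> rt (i - 1) \<noteq> 0\<^sub>v ((m + 1) * n)"
    and p_eq: "\<And>i. i \<in> {1..j} \<Longrightarrow> p i = K *\<^sub>v z i - q i"
    and p_bound: "\<And>i. i \<in> {1..j} \<Longrightarrow>
      vnorm (p i) \<le> sigma j (I_under j - \<mu> \<cdot>\<^sub>m H j) / real j * (1 / vnorm (rt (i - 1))) * \<epsilon>"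
  shows "vnorm (r - rt j) \<le> \<epsilon>"
proof -
  define N where "N = (m + 1) * n"
  have block: "block_matrix n (m + 1) F \<in> carrier_mat N N" for F
    by (rule carrier_matI) (simp_all add: block_matrix_def N_def)
  have K: "K \<in> carrier_mat N N" and M: "M \<in> carrier_mat N N"
    unfolding K_eq M_eq K_mat_def M_mat_def by (rule block)+
  have c: "c \<in> carrier_vec N"
    using b_dim by (auto simp: c_eq c_vec_def N_def intro: carrier_vecI)
  have c_nz: "c \<noteq> 0\<^sub>v N"
  proof
    assume "c = 0\<^sub>v N"
    then have "c $ k = 0" if "k < n" for k using that by (simp add: N_def)
    then have "b $ k = 0" if "k < n" for k using that b_dim by (simp add: c_eq c_vec_def)
    then show False using b_nz b_dim by (auto intro!: eq_vecI)
  qed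
  note q = inexact_infinite_gmres_q_carrier[OF run c]
  note orth = inexact_infinite_gmres_orthonormal[OF run c c_nz M]
  have z: "z i \<in> carrier_vec N" if "i \<in> {1..j}" for i
    unfolding inexact_infinite_gmres_step(1)[OF run that] K_inv_approx_def
    by (rule mult_mat_vec_carrier[OF block]) (use q[of "i - 1"] that in auto)
  have p_dim: "p i \<in> carrier_vec N" if "i \<in> {1..j}" for i
    using p_eq[OF that] q[of "i - 1"] that K by (auto intro: carrier_vecI)
  define G where "G = I_under j - \<mu> \<cdot>\<^sub>m H j"
  have G: "G \<in> carrier_mat (j + 1) j" by (simp add: G_def H_eq)
  have w: "w i \<in> carrier_vec i" if "i \<in> {1..j}" for i
    using w_min[OF that] by (simp add: is_arg_min_def)
  have wj: "w j \<in> carrier_vec j" using w j_ge by simp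
  \<comment> \<open>Every earlier exact residual has the norm of a step-\<open>j\<close> residual
    whose coefficients vanish from position \<open>i\<close> on.\<close>
  have rt_norm: "\<exists>u\<in>carrier_vec j. (\<forall>k\<in>{i..<j}. u $ k = 0) \<and>
      vnorm (rt i) = vnorm (vnorm c \<cdot>\<^sub>v unit_vec (j + 1) 0 - G *\<^sub>v u)" if i: "i < j" for i
  proof -
    \<comment> \<open>At \<open>i = 0\<close> there is no least-squares solution; the empty vector
      stands in and gives the residual norm \<open>vnorm c\<close>, matching
      \<open>rt 0 = c\<close>.\<close>
    define x where "x = (if i = 0 then 0\<^sub>v 0 else w i)"
    have x: "x \<in> carrier_vec i" using w i by (auto simp: x_def)
    have "vnorm (rt i) =
        vnorm (vnorm c \<cdot>\<^sub>v unit_vec (i + 1) 0 - (I_under i - \<mu> \<cdot>\<^sub>m hessenberg h \<beta> i) *\<^sub>v x)"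
    proof (cases "i = 0")
      case True
      then have "vnorm c \<cdot>\<^sub>v unit_vec (i + 1) 0 - (I_under i - \<mu> \<cdot>\<^sub>m hessenberg h \<beta> i) *\<^sub>v x =
          vnorm c \<cdot>\<^sub>v unit_vec 1 0"
        by (intro eq_vecI) (auto simp: x_def I_under_def scalar_prod_def)
      moreover have "vnorm (unit_vec 1 0) = 1" by (simp add: vnorm_def)
      ultimately show ?thesis using True by (simp add: rt_0 vnorm_smult)
    next
      case False
      then have i': "i \<in> {1..j}" using i by simp
      have "vnorm (rt i) = vnorm (cols_upto N q (i + 1) *\<^sub>v
          (vnorm c \<cdot>\<^sub>v unit_vec (i + 1) 0 - (I_under i - \<mu> \<cdot>\<^sub>m hessenberg h \<beta> i) *\<^sub>v x))"
        using False by (simp add: rt_eq[OF i'] Q_eq H_eq N_def x_def)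
      also have "\<dots> =
          vnorm (vnorm c \<cdot>\<^sub>v unit_vec (i + 1) 0 - (I_under i - \<mu> \<cdot>\<^sub>m hessenberg h \<beta> i) *\<^sub>v x)"
        using i by (intro vnorm_cols_upto_mult_orthonormal q orth)
          (auto intro!: carrier_vecI simp: I_under_def)
      finally show ?thesis .
    qed
    also have "\<dots> = vnorm (vnorm c \<cdot>\<^sub>v unit_vec (j + 1) 0 -
        G *\<^sub>v vec j (\<lambda>s. if s < i then x $ s else 0))"
      unfolding G_def H_eq
      by (rule shifted_hessenberg_residual_pad[symmetric]) (use x i in auto)
    finally show ?thesis by (intro bexI[of _ "vec j (\<lambda>s. if s < i then x $ s else 0)"]) auto
  qed
  \<comment> \<open>Position \<open>s\<close> holds the coefficient of \<open>z (Suc s)\<close>, so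
    \<open>rt s\<close> is the residual just before that step, as in the bound on
    \<open>p (Suc s)\<close>.\<close>
  have w_decay: "sigma j G * \<bar>w j $ s\<bar> \<le> vnorm (rt s)" if s: "s < j" for s
  \<comment> \<open>The negative case is trivial, and treating it avoids a separate proof that
    singular values are nonnegative.\<close>
  proof (cases "sigma j G \<ge> 0")
    case True
    obtain u where u: "u \<in> carrier_vec j" "\<forall>k\<in>{s..<j}. u $ k = 0"
      and rt_u: "vnorm (rt s) = vnorm (vnorm c \<cdot>\<^sub>v unit_vec (j + 1) 0 - G *\<^sub>v u)"
      using rt_norm[OF s] by blast
    have diff: "w j - u \<in> carrier_vec j" using wj u by simp
    \<comment> \<open>Since \<open>u\<close> vanishes at \<open>s\<close>, the entry of the
      difference there is \<open>w j $ s\<close> itself.\<close>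
    have "\<bar>w j $ s\<bar> \<le> vnorm (w j - u)"
      using abs_index_le_vnorm[of s "w j - u"] u s by simp
    then have "sigma j G * \<bar>w j $ s\<bar> \<le> sigma j G * vnorm (w j - u)"
      using True by (rule mult_left_mono)
    also have "\<dots> \<le> vnorm (G *\<^sub>v (w j - u))"
      using j_ge by (intro sigma_min_le[OF G _ diff]) simp
    also have "\<dots> \<le> vnorm (rt s)"
      unfolding rt_u using w_min[of j] j_ge
      by (intro least_squares_error_le[OF G _ _ u(1)]) (auto simp: G_def)
    finally show ?thesis .
  next
    case False
    then have "sigma j G * \<bar>w j $ s\<bar> \<le> 0" by (simp add: mult_nonpos_nonneg)
    also have "\<dots> \<le> vnorm (rt s)" by simp
    finally show ?thesis .
  qed
  have "r - rt j = - (cols_upto N p j *\<^sub>v w j)"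
    using inexact_infinite_gmres_residual_gap[OF run c c_nz M K z p_eq wj, of \<mu>] rt_eq[of j] j_ge
    by (simp add: r_eq v_eq Z_eq Q_eq H_eq N_def)
  then have "vnorm (r - rt j) = vnorm (cols_upto N p j *\<^sub>v w j)"
    by (simp add: vnorm_uminus)
  also have "\<dots> \<le> (\<Sum>s<j. vnorm (p (Suc s)) * \<bar>w j $ s\<bar>)"
    using wj p_dim by (intro vnorm_cols_upto_mult_le) auto
  \<comment> \<open>The factor \<open>1 / real j\<close> in the bound on the inner residuals gives
    each of the \<open>j\<close> columns an equal share of \<epsilon>; \<open>w_decay\<close>
    absorbs the rest.\<close>
  also have "\<dots> \<le> (\<Sum>s<j. \<epsilon> / real j)"
  proof (rule sum_mono)
    fix s assume "s \<in> {..<j}"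
    then have s: "s < j" by simp
    have "vnorm (p (Suc s)) * \<bar>w j $ s\<bar> \<le>
        sigma j G / real j * (1 / vnorm (rt s)) * \<epsilon> * \<bar>w j $ s\<bar>"
      using p_bound[of "Suc s"] s by (intro mult_right_mono) (auto simp: G_def)
    also have "\<dots> = \<epsilon> / real j * (sigma j G * \<bar>w j $ s\<bar> / vnorm (rt s))"
      by simp
    also have "\<dots> \<le> \<epsilon> / real j * 1"
      using w_decay[OF s] eps by (intro mult_left_mono) (auto simp: divide_le_eq_1 less_le)
    finally show "vnorm (p (Suc s)) * \<bar>w j $ s\<bar> \<le> \<epsilon> / real j" by simp
  qed
  also have "\<dots> = \<epsilon>" using j_ge by simp
  finally show ?thesis .
qed

end
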